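(* Let $S=(S_k)_{k\in\mathbb{N}_0}$ be a nonnegative martingale on a filtered probability space $(\Omega,\mathcal{F},(\mathcal{F}_k)_{k\in\mathbb{N}_0},\mathbb{P})$, and let $S_\infty$ denote its $\mathbb{P}$-a.s. limit. For $k\in\mathbb{N}_0$ define the stopping time $\tilde\tau_k:=\inf\{j>k: S_j<S_{j-1}\}$. Then the following are equivalent: (a) $S$ is a bubble. (b) There exists $k\ge 0$ such that $\mathbb{E}[S_{\tilde\tau_k}]<\mathbb{E}[S_k]$. (c) There exists $k\ge 0$ such that $\lim_{n\to\infty}\mathbb{E}\big[(S_n-S_\infty)\mathbf{1}_{\{S_k\le S_{k+1}\le\dots\le S_n\}}\big]>0$.
   Context: A nonnegative martingale $S=(S_k)_{k\in\mathbb{N}_0}$ converges $\mathbb{P}$-a.s. to an integrable random variable $S_\infty$; for a stopping time $\tau$ with values in $\mathbb{N}_0\cup\{\infty\}$, $S_\tau:=S_\infty$ on $\{\tau=\infty\}$. Convention: $\inf\emptyset=\infty$. Definition (bubble): put $\tau_0:=0$ and $\tau_k:=\inf\{j>\tau_{k-1}: S_j<S_{j-1}\}$ for $k\in\mathbb{N}$ (the $k$-th drawdown). The nonnegative martingale $S$ is a bubble (and $\mathbb{P}$ is a bubble measure for $S$) if $\mathbb{E}[S_{\tau_k}]<\mathbb{E}[S_0]$ for some $k\in\mathbb{N}$. *)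

theory Defs
  imports "HOL-Probability.Probability"
begin

locale filtered_prob_space = prob_space M + filtration "space M" F
  for M :: "'a measure" and F :: "nat \<Rightarrow> 'a measure" +
  assumes subalgebra_F: "\<And>k. subalgebra M (F k)"

locale nonneg_martingale = filtered_prob_space M F
  for M :: "'a measure" and F :: "nat \<Rightarrow> 'a measure" +
  fixes S :: "nat \<Rightarrow> 'a \<Rightarrow> real"
  assumes adapted: "\<And>k. S k \<in> borel_measurable (F k)"
    and integrable: "\<And>k. integrable M (S k)"
    and martingale: "\<And>i j. i \<le> j \<Longrightarrow> AE \<omega> in M. real_cond_exp M (F i) (S j) \<omega> = S i \<omega>"
    and nonneg: "\<And>k. AE \<omega> in M. 0 \<le> S k \<omega>"

text \<open>
  A nonnegative martingale converges almost surely, so the fixed but unspecified value that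
  \<open>lim\<close> takes at a divergent path only matters on a null set.
\<close>

definition limit_value :: "(nat \<Rightarrow> 'a \<Rightarrow> real) \<Rightarrow> 'a \<Rightarrow> real" where
  "limit_value S \<omega> = lim (\<lambda>n. S n \<omega>)"

definition stopped_value :: "(nat \<Rightarrow> 'a \<Rightarrow> real) \<Rightarrow> ('a \<Rightarrow> enat) \<Rightarrow> 'a \<Rightarrow> real" where
  "stopped_value S T \<omega> = (case T \<omega> of enat n \<Rightarrow> S n \<omega> | \<infinity> \<Rightarrow> limit_value S \<omega>)"

text \<open>
  The infimum is taken in \<^typ>\<open>enat\<close>, where the infimum of the empty set is \<open>\<infinity>\<close>.
  Every \<open>j\<close> in the set is positive, so the subtraction \<open>j - 1\<close> does not truncate.
\<close>

definition drawdown_after :: "(nat \<Rightarrow> 'a \<Rightarrow> real) \<Rightarrow> enat \<Rightarrow> 'a \<Rightarrow> enat" where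
  "drawdown_after S t \<omega> = Inf {enat j | j. t < enat j \<and> S j \<omega> < S (j - 1) \<omega>}"

primrec drawdown_time :: "(nat \<Rightarrow> 'a \<Rightarrow> real) \<Rightarrow> nat \<Rightarrow> 'a \<Rightarrow> enat" where
  "drawdown_time S 0 \<omega> = 0"
| "drawdown_time S (Suc k) \<omega> = drawdown_after S (drawdown_time S k \<omega>) \<omega>"

definition bubble :: "'a measure \<Rightarrow> (nat \<Rightarrow> 'a \<Rightarrow> real) \<Rightarrow> bool" where
  "bubble M S \<longleftrightarrow>
    (\<exists>k\<ge>1. (\<integral>\<omega>. stopped_value S (drawdown_time S k) \<omega> \<partial>M) < (\<integral>\<omega>. S 0 \<omega> \<partial>M))"

definition nondecreasing_event :: "'a measure \<Rightarrow> (nat \<Rightarrow> 'a \<Rightarrow> real) \<Rightarrow> nat \<Rightarrow> nat \<Rightarrow> 'a set" where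
  "nondecreasing_event M S k n = {\<omega> \<in> space M. \<forall>i\<in>{k..<n}. S i \<omega> \<le> S (Suc i) \<omega>}"

end

(*
  For every stopping time T one has E S_0 - E S_T = lim E[(S_n - S_oo) 1{T > n}], because the stopped
  process has constant expectation; applied to the first drawdown after k this is the
  equivalence of (b) and (c).  For sigma <= T such that S converges a.s. on {T = oo}, Fatou's lemma
  turns the identity into E S_T <= E S_sigma.  Since the k-th drawdown cannot occur before time k,
  the (k+1)-st one comes no earlier than the first one after k, which gives (b) ==> (a).  Conversely, if no first
  drawdown after a deterministic time loses mass, then splitting according to the value of tau_m
  shows that no mass is lost between tau_m and tau_(m+1).

  The martingale convergence theorem is not needed: if some tau_m is infinite, then the path is
  eventually nondecreasing, and such paths converge a.s. by Fatou's lemma; for the integrability of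
  S_oo it is enough that limit_value is constant on the set of divergent paths.
*)
theory Submission
  imports Defs
begin

section \<open>Fatou's lemma for Bochner integrals\<close>

text \<open>The detour through \<open>ennreal\<close> yields integrability of the limit together
  with the bound. A bound holding only eventually suffices, which lets the version for convergent
  expectations be derived from it.\<close>

lemma integral_Fatou:
  fixes X :: "nat \<Rightarrow> 'a \<Rightarrow> real"
  assumes int: "\<And>n. integrable M (X n)"
    and nonneg: "\<And>n. AE \<omega> in M. 0 \<le> X n \<omega>"
    and lim: "AE \<omega> in M. (\<lambda>n. X n \<omega>) \<longlonglongrightarrow> Y \<omega>"
    and meas: "Y \<in> borel_measurable M"
    and bound: "eventually (\<lambda>n. (\<integral>\<omega>. X n \<omega> \<partial>M) \<le> C) sequentially"
  shows "integrable M Y" and "(\<integral>\<omega>. Y \<omega> \<partial>M) \<le> C"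
proof -
  have pos: "AE \<omega> in M. \<forall>n. 0 \<le> X n \<omega>"
    using nonneg by (simp add: AE_all_countable)
  have Ypos: "AE \<omega> in M. 0 \<le> Y \<omega>"
    using pos lim by eventually_elim (auto intro: LIMSEQ_le_const)
  \<comment> \<open>\<open>ennreal\<close> sends negative reals to 0, so the sign of
    \<open>C\<close> is needed to read the last inequality back in the reals.\<close>
  have C: "0 \<le> C"
  proof -
    obtain n where "(\<integral>\<omega>. X n \<omega> \<partial>M) \<le> C"
      using bound eventually_sequentially by auto
    moreover have "0 \<le> (\<integral>\<omega>. X n \<omega> \<partial>M)"
      by (rule integral_nonneg_AE[OF nonneg])
    ultimately show ?thesis by linarith
  qed
  have "(\<integral>\<^sup>+\<omega>. ennreal (Y \<omega>) \<partial>M) = (\<integral>\<^sup>+\<omega>. liminf (\<lambda>n. ennreal (X n \<omega>)) \<partial>M)"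
    using lim by (intro nn_integral_cong_AE)
      (auto elim!: eventually_mono intro!: lim_imp_Liminf[symmetric])
  also have "\<dots> \<le> liminf (\<lambda>n. \<integral>\<^sup>+\<omega>. ennreal (X n \<omega>) \<partial>M)"
    using int by (intro nn_integral_liminf) auto
  also have "\<dots> = liminf (\<lambda>n. ennreal (\<integral>\<omega>. X n \<omega> \<partial>M))"
    using nn_integral_eq_integral[OF int nonneg] by simp
  also have "\<dots> \<le> ennreal C"
    using bound by (intro order_trans[OF Liminf_le_Limsup Limsup_bounded])
      (auto elim!: eventually_mono intro: ennreal_leI)
  finally have le: "(\<integral>\<^sup>+\<omega>. ennreal (Y \<omega>) \<partial>M) \<le> ennreal C" .
  show int_Y: "integrable M Y"
    using le_less_trans[OF le ennreal_less_top] Ypos meas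
    by (intro integrableI_nonneg) auto
  show "(\<integral>\<omega>. Y \<omega> \<partial>M) \<le> C"
    using le nn_integral_eq_integral[OF int_Y Ypos] C by simp
qed

text \<open>Expectations converging to \<open>C\<close> are eventually below \<open>C + e\<close>
  for each \<open>e > 0\<close>, so the preceding bound applies with \<open>C + e\<close>.\<close>

lemma integral_Fatou_tendsto:
  fixes X :: "nat \<Rightarrow> 'a \<Rightarrow> real"
  assumes "\<And>n. integrable M (X n)"
    and "\<And>n. AE \<omega> in M. 0 \<le> X n \<omega>"
    and "AE \<omega> in M. (\<lambda>n. X n \<omega>) \<longlonglongrightarrow> Y \<omega>"
    and "Y \<in> borel_measurable M"
    and lim: "(\<lambda>n. \<integral>\<omega>. X n \<omega> \<partial>M) \<longlonglongrightarrow> C"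
  shows "(\<integral>\<omega>. Y \<omega> \<partial>M) \<le> C"
proof (rule field_le_epsilon)
  fix e :: real
  assume "0 < e"
  then have "eventually (\<lambda>n. (\<integral>\<omega>. X n \<omega> \<partial>M) < C + e) sequentially"
    by (intro order_tendstoD[OF lim]) simp
  then have "eventually (\<lambda>n. (\<integral>\<omega>. X n \<omega> \<partial>M) \<le> C + e) sequentially"
    by eventually_elim simp
  then show "(\<integral>\<omega>. Y \<omega> \<partial>M) \<le> C + e"
    using assms(1-4) by (rule integral_Fatou(2)[rotated -1])
qed


section \<open>Drawdown times\<close>

text \<open>In the well-order \<open>enat\<close> a nonempty set attains its infimum, and the empty
  set has infimum \<open>\<infinity>\<close>, which is not below \<open>enat n\<close>.\<close>

lemma Inf_enat_le_iff:
  fixes A :: "enat set"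
  shows "Inf A \<le> enat n \<longleftrightarrow> (\<exists>a\<in>A. a \<le> enat n)"
proof
  assume le: "Inf A \<le> enat n"
  then have "A \<noteq> {}"
    by (auto simp: Inf_enat_def)
  then have "Inf A \<in> A"
    by (rule wellorder_InfI[OF ex_in_conv[THEN iffD2, THEN someI_ex]])
  with le show "\<exists>a\<in>A. a \<le> enat n" ..
qed (meson Inf_lower order_trans)

text \<open>Only indices \<open>j \<le> n\<close> occur on the right, so the event is decided by the
  path up to time \<open>n\<close>; the stopping time property rests on this.\<close>

lemma drawdown_after_le_iff:
  "drawdown_after S t \<omega> \<le> enat n \<longleftrightarrow> (\<exists>j\<le>n. t < enat j \<and> S j \<omega> < S (j - 1) \<omega>)"
  unfolding drawdown_after_def Inf_enat_le_iff by auto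

lemma drawdown_after_mono: "t \<le> u \<Longrightarrow> drawdown_after S t \<omega> \<le> drawdown_after S u \<omega>"
  unfolding drawdown_after_def by (rule Inf_superset_mono) auto

lemma drawdown_after_ge: "t \<le> drawdown_after S t \<omega>"
  unfolding drawdown_after_def by (rule Inf_greatest) auto

lemma drawdown_after_ge_Suc: "enat (Suc k) \<le> drawdown_after S (enat k) \<omega>"
  unfolding drawdown_after_def by (rule Inf_greatest) auto

lemma drawdown_after_infinity [simp]: "drawdown_after S \<infinity> \<omega> = \<infinity>"
  by (simp add: drawdown_after_def Inf_enat_def)

lemma drawdown_after_eq_infinityD:
  assumes "drawdown_after S (enat k) \<omega> = \<infinity>" "k \<le> i"
  shows "S i \<omega> \<le> S (Suc i) \<omega>"
proof (rule ccontr)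
  assume "\<not> S i \<omega> \<le> S (Suc i) \<omega>"
  then have "drawdown_after S (enat k) \<omega> \<le> enat (Suc i)"
    unfolding drawdown_after_le_iff using assms(2) by (intro exI[of _ "Suc i"]) auto
  with assms(1) show False by simp
qed

text \<open>Each new drawdown advances time by at least one step.\<close>

lemma drawdown_time_ge: "enat k \<le> drawdown_time S k \<omega>"
proof (induction k)
  case (Suc k)
  have "enat (Suc k) \<le> drawdown_after S (enat k) \<omega>"
    by (rule drawdown_after_ge_Suc)
  also have "\<dots> \<le> drawdown_time S (Suc k) \<omega>"
    using Suc.IH by (simp add: drawdown_after_mono)
  finally show ?case .
qed (simp add: zero_enat_def)

text \<open>After the last finite drawdown time \<open>N\<close> the path never decreases again; if
  the preceding drawdown time is already infinite, the induction hypothesis applies.\<close>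

lemma drawdown_time_eq_infinityD:
  "drawdown_time S m \<omega> = \<infinity> \<Longrightarrow> \<exists>N. \<forall>i\<ge>N. S i \<omega> \<le> S (Suc i) \<omega>"
proof (induction m)
  case (Suc m)
  show ?case
  proof (cases "drawdown_time S m \<omega>")
    case (enat N)
    with Suc.prems show ?thesis
      by (auto intro: drawdown_after_eq_infinityD)
  qed (use Suc.IH in auto)
qed simp

text \<open>The shift \<open>j = Suc i\<close> matches the steps \<open>i\<close> in
  \<open>{k..<n}\<close> with the possible drawdowns \<open>j\<close> with
  \<open>k < j \<le> n\<close>. For \<open>n \<le> k\<close> both sides are 1, since the first
  drawdown after \<open>k\<close> is later than \<open>k\<close>. Condition (c) thus becomes a
  statement about a stopping time that exceeds \<open>n\<close>.\<close>

lemma indicator_nondecreasing_event: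
  assumes "\<omega> \<in> space M"
  shows "(indicator (nondecreasing_event M S k n) \<omega> :: real)
    = of_bool (enat n < drawdown_after S (enat k) \<omega>)"
proof -
  have "(\<forall>i\<in>{k..<n}. S i \<omega> \<le> S (Suc i) \<omega>) \<longleftrightarrow> \<not> drawdown_after S (enat k) \<omega> \<le> enat n"
  proof
    assume mono: "\<forall>i\<in>{k..<n}. S i \<omega> \<le> S (Suc i) \<omega>"
    show "\<not> drawdown_after S (enat k) \<omega> \<le> enat n"
    proof
      assume "drawdown_after S (enat k) \<omega> \<le> enat n"
      then obtain j where j: "j \<le> n" "k < j" "S j \<omega> < S (j - 1) \<omega>"
        by (auto simp: drawdown_after_le_iff)
      then have "S (j - 1) \<omega> \<le> S (Suc (j - 1)) \<omega>"
        by (intro bspec[OF mono]) auto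
      with j show False by simp
    qed
  next
    assume *: "\<not> drawdown_after S (enat k) \<omega> \<le> enat n"
    show "\<forall>i\<in>{k..<n}. S i \<omega> \<le> S (Suc i) \<omega>"
    proof
      fix i assume "i \<in> {k..<n}"
      with * show "S i \<omega> \<le> S (Suc i) \<omega>"
        unfolding drawdown_after_le_iff by (auto dest!: spec[of _ "Suc i"])
    qed
  qed
  with assms show ?thesis
    by (auto simp: nondecreasing_event_def indicator_def not_le)
qed


section \<open>Stopped nonnegative martingales\<close>

text \<open>The filtration is indexed by \<open>nat\<close> while times live in \<open>enat\<close>,
  so only finite \<open>n\<close> are tested; the event that \<open>T\<close> is infinite is the
  complement of the union of the tested events.\<close>

definition enat_stopping_time :: "(nat \<Rightarrow> 'a measure) \<Rightarrow> ('a \<Rightarrow> enat) \<Rightarrow> bool" where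
  "enat_stopping_time F T \<longleftrightarrow> (\<forall>n. Measurable.pred (F n) (\<lambda>\<omega>. T \<omega> \<le> enat n))"

lemma stopped_value_enat: "T \<omega> = enat n \<Longrightarrow> stopped_value S T \<omega> = S n \<omega>"
  by (simp add: stopped_value_def)

lemma stopped_value_infinity: "T \<omega> = \<infinity> \<Longrightarrow> stopped_value S T \<omega> = limit_value S \<omega>"
  by (simp add: stopped_value_def)

context nonneg_martingale
begin

section \<open>Measurability along the filtration and stopping times\<close>

lemma subalgebra_mono: "i \<le> j \<Longrightarrow> subalgebra (F j) (F i)"
  by (simp add: subalgebra_def space_F sets_F_mono)

lemma pred_F_mono: "Measurable.pred (F i) P \<Longrightarrow> i \<le> j \<Longrightarrow> Measurable.pred (F j) P"
  by (rule measurable_from_subalg[OF subalgebra_mono])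

lemma pred_F_M: "Measurable.pred (F i) P \<Longrightarrow> Measurable.pred M P"
  by (rule measurable_from_subalg[OF subalgebra_F])

lemma adapted_mono: "i \<le> j \<Longrightarrow> S i \<in> borel_measurable (F j)"
  by (rule measurable_from_subalg[OF subalgebra_mono adapted])

lemma S_measurable [measurable]: "S n \<in> borel_measurable M"
  by (rule measurable_from_subalg[OF subalgebra_F adapted])

lemma stopping_time_pred:
  assumes "enat_stopping_time F T"
  shows "Measurable.pred (F n) (\<lambda>\<omega>. T \<omega> \<le> enat n)"
    and "Measurable.pred (F n) (\<lambda>\<omega>. enat n < T \<omega>)"
    and "Measurable.pred M (\<lambda>\<omega>. T \<omega> \<le> enat n)"
    and "Measurable.pred M (\<lambda>\<omega>. enat n < T \<omega>)"
proof -
  show 1: "Measurable.pred (F n) (\<lambda>\<omega>. T \<omega> \<le> enat n)"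
    using assms by (simp add: enat_stopping_time_def)
  then show 2: "Measurable.pred (F n) (\<lambda>\<omega>. enat n < T \<omega>)"
    unfolding not_le[symmetric] by measurable
  show "Measurable.pred M (\<lambda>\<omega>. T \<omega> \<le> enat n)" "Measurable.pred M (\<lambda>\<omega>. enat n < T \<omega>)"
    using 1 2 by (auto intro: pred_F_M)
qed

lemma stopping_time_eq_pred:
  assumes "enat_stopping_time F T"
  shows "Measurable.pred (F n) (\<lambda>\<omega>. T \<omega> = enat n)"
proof (cases n)
  case 0
  have "(\<lambda>\<omega>. T \<omega> = enat n) = (\<lambda>\<omega>. T \<omega> \<le> enat n)"
    using 0 by (auto simp: zero_enat_def[symmetric])
  then show ?thesis
    using stopping_time_pred(1)[OF assms] by simp
next
  case (Suc m)
  have eq: "t = enat n \<longleftrightarrow> t \<le> enat n \<and> \<not> t \<le> enat m" for t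
    using Suc by (cases t) auto
  have [measurable]: "Measurable.pred (F n) (\<lambda>\<omega>. T \<omega> \<le> enat n)"
    "Measurable.pred (F n) (\<lambda>\<omega>. T \<omega> \<le> enat m)"
    using stopping_time_pred(1)[OF assms] Suc by (auto intro: pred_F_mono[where i = m])
  show ?thesis
    unfolding eq by measurable
qed

lemma stopping_time_const: "enat_stopping_time F (\<lambda>\<omega>. enat j)"
  by (simp add: enat_stopping_time_def)

text \<open>For \<open>j = Suc i \<le> n\<close> the condition \<open>T \<omega> < enat j\<close>
  reads \<open>T \<omega> \<le> enat i\<close> and is known at time \<open>n\<close>, as are
  \<open>S j\<close> and \<open>S (j - 1)\<close>; the event is a finite union over such
  \<open>j\<close>.\<close>

lemma stopping_time_drawdown_after:
  assumes "enat_stopping_time F T"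
  shows "enat_stopping_time F (\<lambda>\<omega>. drawdown_after S (T \<omega>) \<omega>)"
  unfolding enat_stopping_time_def drawdown_after_le_iff
proof
  fix n
  have "Measurable.pred (F n) (\<lambda>\<omega>. T \<omega> < enat j \<and> S j \<omega> < S (j - 1) \<omega>)" if "j \<le> n" for j
  proof (cases j)
    case 0
    then show ?thesis by simp
  next
    case (Suc i)
    have eq: "t < enat j \<longleftrightarrow> t \<le> enat i" for t
      using Suc by (cases t) auto
    have [measurable]: "Measurable.pred (F n) (\<lambda>\<omega>. T \<omega> \<le> enat i)"
      using stopping_time_pred(1)[OF assms] Suc that by (auto intro: pred_F_mono[where i = i])
    have [measurable]: "S j \<in> borel_measurable (F n)" "S (j - 1) \<in> borel_measurable (F n)"
      using that by (auto intro: adapted_mono)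
    show ?thesis
      unfolding eq by measurable
  qed
  then have "Measurable.pred (F n) (\<lambda>\<omega>. \<exists>j\<in>{..n}. T \<omega> < enat j \<and> S j \<omega> < S (j - 1) \<omega>)"
    by (intro pred_intros_finite) auto
  then show "Measurable.pred (F n) (\<lambda>\<omega>. \<exists>j\<le>n. T \<omega> < enat j \<and> S j \<omega> < S (j - 1) \<omega>)"
    unfolding Bex_def atMost_iff .
qed

lemma stopping_time_drawdown_time: "enat_stopping_time F (drawdown_time S k)"
proof (induction k)
  case 0
  then show ?case
    using stopping_time_const[of 0] by (simp add: zero_enat_def enat_stopping_time_def)
next
  case (Suc k)
  then show ?case
    using stopping_time_drawdown_after[OF Suc] by (simp add: enat_stopping_time_def)
qed

text \<open>The martingale property integrated over an event of \<open>F i\<close>; every later use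
  of that property goes through this identity.\<close>

lemma expectation_martingale_on:
  assumes "Measurable.pred (F i) P" "i \<le> j"
  shows "(\<integral>\<omega>. S j \<omega> * of_bool (P \<omega>) \<partial>M) = (\<integral>\<omega>. S i \<omega> * of_bool (P \<omega>) \<partial>M)"
proof -
  interpret sub: finite_measure_subalgebra M "F i"
    by unfold_locales (rule subalgebra_F)
  define A where "A = {\<omega> \<in> space (F i). P \<omega>}"
  have A: "A \<in> sets (F i)"
    using assms(1) by (simp add: A_def pred_def)
  have ind: "of_bool (P \<omega>) = (indicator A \<omega> :: real)" if "\<omega> \<in> space M" for \<omega>
    using that by (auto simp: A_def space_F indicator_def)
  have "(\<integral>\<omega>. S j \<omega> * of_bool (P \<omega>) \<partial>M) = (\<integral>\<omega>\<in>A. S j \<omega> \<partial>M)"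
    unfolding set_lebesgue_integral_def by (rule Bochner_Integration.integral_cong) (auto simp: ind)
  also have "\<dots> = (\<integral>\<omega>\<in>A. real_cond_exp M (F i) (S j) \<omega> \<partial>M)"
    by (rule sub.real_cond_exp_intA[OF integrable A])
  also have "\<dots> = (\<integral>\<omega>\<in>A. S i \<omega> \<partial>M)"
    using martingale[OF assms(2)] unfolding set_lebesgue_integral_def
    by (intro integral_cong_AE)
      (use A subalgebra_F[of i] in \<open>auto simp: subalgebra_def elim!: eventually_mono\<close>)
  also have "\<dots> = (\<integral>\<omega>. S i \<omega> * of_bool (P \<omega>) \<partial>M)"
    unfolding set_lebesgue_integral_def by (rule Bochner_Integration.integral_cong) (auto simp: ind)
  finally show ?thesis .
qed

lemma expectation_const: "(\<integral>\<omega>. S j \<omega> \<partial>M) = (\<integral>\<omega>. S 0 \<omega> \<partial>M)"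
  using expectation_martingale_on[where i = 0 and j = j and P = "\<lambda>_. True"] by simp

lemma nonneg_all: "AE \<omega> in M. \<forall>n. 0 \<le> S n \<omega>"
  using nonneg by (simp add: AE_all_countable)

lemma integrable_mult_of_bool:
  fixes X :: "'a \<Rightarrow> real"
  assumes X: "integrable M X" and [measurable]: "Measurable.pred M P"
  shows "integrable M (\<lambda>\<omega>. X \<omega> * of_bool (P \<omega>))"
proof (rule Bochner_Integration.integrable_bound[OF X])
  have [measurable]: "X \<in> borel_measurable M"
    using X by simp
  show "(\<lambda>\<omega>. X \<omega> * of_bool (P \<omega>)) \<in> borel_measurable M"
    by measurable
qed auto

section \<open>The limit value: integrability and convergence\<close>

lemma limit_value_measurable [measurable]: "limit_value S \<in> borel_measurable M"
  unfolding limit_value_def[abs_def] by measurable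

text \<open>On convergent paths Fatou's lemma applies, because the expectations of
  \<open>S n\<close> are constant; divergent paths are treated separately.\<close>

lemma integrable_limit_value: "integrable M (limit_value S)"
proof -
  define conv where "conv \<omega> = convergent (\<lambda>n. S n \<omega>)" for \<omega>
  \<comment> \<open>Convergence is expressed by the Cauchy criterion, whose set of paths is
    measurable.\<close>
  have [measurable]: "Measurable.pred M conv"
    unfolding conv_def[abs_def] Cauchy_convergent_iff[symmetric] pred_def
    by (rule sets_Collect_Cauchy) measurable
  have "integrable M (\<lambda>\<omega>. limit_value S \<omega> * of_bool (conv \<omega>))"
  proof (rule integral_Fatou(1))
    show "integrable M (\<lambda>\<omega>. S n \<omega> * of_bool (conv \<omega>))" for n
      by (rule integrable_mult_of_bool[OF integrable]) measurable
    show "AE \<omega> in M. 0 \<le> S n \<omega> * of_bool (conv \<omega>)" for n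
      using nonneg[of n] by eventually_elim auto
    show "AE \<omega> in M. (\<lambda>n. S n \<omega> * of_bool (conv \<omega>)) \<longlonglongrightarrow> limit_value S \<omega> * of_bool (conv \<omega>)"
      by (auto simp: conv_def limit_value_def convergent_LIMSEQ_iff)
    show "(\<lambda>\<omega>. limit_value S \<omega> * of_bool (conv \<omega>)) \<in> borel_measurable M"
      by measurable
    have "(\<integral>\<omega>. S n \<omega> * of_bool (conv \<omega>) \<partial>M) \<le> (\<integral>\<omega>. S 0 \<omega> \<partial>M)" for n
      unfolding expectation_const[of n, symmetric]
      using nonneg[of n] by (intro integral_mono_AE integrable_mult_of_bool integrable)
        (auto elim!: eventually_mono)
    then show "eventually (\<lambda>n. (\<integral>\<omega>. S n \<omega> * of_bool (conv \<omega>) \<partial>M) \<le> (\<integral>\<omega>. S 0 \<omega> \<partial>M)) sequentially"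
      by simp
  qed
  \<comment> \<open>On a divergent path no real satisfies the description behind \<open>lim\<close>,
    so \<open>lim\<close> is \<open>THE l. False\<close>: one constant for all such paths,
    integrable under a probability measure.\<close>
  moreover have "integrable M (\<lambda>\<omega>. (THE l::real. False) * of_bool (\<not> conv \<omega>))"
    by (rule integrable_mult_of_bool) auto
  ultimately have "integrable M (\<lambda>\<omega>. limit_value S \<omega> * of_bool (conv \<omega>)
      + (THE l. False) * of_bool (\<not> conv \<omega>))"
    by (rule Bochner_Integration.integrable_add)
  also have "(\<lambda>\<omega>. limit_value S \<omega> * of_bool (conv \<omega>) + (THE l. False) * of_bool (\<not> conv \<omega>))
      = limit_value S"
    by (auto simp: fun_eq_iff conv_def limit_value_def lim_def convergent_def)
  finally show ?thesis .
qed

text \<open>By Fatou's lemma the lower limit of the path is almost surely finite. A path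
  nondecreasing from \<open>N\<close> on is bounded there by its lower limit, hence
  converges.\<close>

lemma AE_eventually_mono_convergent:
  "AE \<omega> in M. (\<exists>N. \<forall>i\<ge>N. S i \<omega> \<le> S (Suc i) \<omega>) \<longrightarrow> (\<lambda>n. S n \<omega>) \<longlonglongrightarrow> limit_value S \<omega>"
proof -
  have "(\<integral>\<^sup>+\<omega>. liminf (\<lambda>n. ennreal (S n \<omega>)) \<partial>M) \<le> liminf (\<lambda>n. \<integral>\<^sup>+\<omega>. ennreal (S n \<omega>) \<partial>M)"
    by (rule nn_integral_liminf) measurable
  also have "\<dots> = ennreal (\<integral>\<omega>. S 0 \<omega> \<partial>M)"
    by (subst nn_integral_eq_integral[OF integrable nonneg], subst expectation_const)
      (simp add: Liminf_const)
  finally have "(\<integral>\<^sup>+\<omega>. liminf (\<lambda>n. ennreal (S n \<omega>)) \<partial>M) \<noteq> \<infinity>"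
    by (auto simp: top_unique)
  then have "AE \<omega> in M. liminf (\<lambda>n. ennreal (S n \<omega>)) \<noteq> \<infinity>"
    by (intro nn_integral_PInf_AE) measurable
  then show ?thesis
    using nonneg_all
  proof eventually_elim
    case (elim \<omega>)
    show ?case
    proof
      assume "\<exists>N. \<forall>i\<ge>N. S i \<omega> \<le> S (Suc i) \<omega>"
      then obtain N where N: "\<And>i. i \<ge> N \<Longrightarrow> S i \<omega> \<le> S (Suc i) \<omega>"
        by auto
      have inc: "incseq (\<lambda>i. S (i + N) \<omega>)"
        using N by (intro incseq_SucI) auto
      have "S (i + N) \<omega> \<le> enn2real (liminf (\<lambda>n. ennreal (S n \<omega>)))" for i
      proof -
        have "ennreal (S (i + N) \<omega>) \<le> liminf (\<lambda>n. ennreal (S n \<omega>))"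
        proof (intro Liminf_bounded eventually_sequentiallyI[of "i + N"] ennreal_leI)
          fix n assume "i + N \<le> n"
          then show "S (i + N) \<omega> \<le> S n \<omega>"
            using incseqD[OF inc, of i "n - N"] by simp
        qed
        then show ?thesis
          using elim enn2real_mono[of "ennreal (S (i + N) \<omega>)" "liminf (\<lambda>n. ennreal (S n \<omega>))"]
          by (simp add: top.not_eq_extremum)
      qed
      then have "convergent (\<lambda>i. S (i + N) \<omega>)"
        using incseq_convergent[OF inc] by (metis convergentI)
      then show "(\<lambda>n. S n \<omega>) \<longlonglongrightarrow> limit_value S \<omega>"
        using convergent_ignore_initial_segment[of "\<lambda>n. S n \<omega>" N]
        by (auto simp: convergent_LIMSEQ_iff limit_value_def)
    qed
  qed
qed

section \<open>Expectations at stopping times\<close>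

text \<open>The stopped process at time \<open>n\<close> has expectation \<open>E S_0\<close>, split
  according to whether \<open>T\<close> has occurred by time \<open>n\<close>. In the induction step
  \<open>S n\<close> may be replaced by \<open>S (Suc n)\<close> on
  \<open>enat n < T \<omega>\<close>, an event of \<open>F n\<close>.\<close>

lemma expectation_stopped_process:
  assumes T: "enat_stopping_time F T"
  shows "integrable M (\<lambda>\<omega>. stopped_value S T \<omega> * of_bool (T \<omega> \<le> enat n))"
    and "(\<integral>\<omega>. S n \<omega> * of_bool (enat n < T \<omega>) \<partial>M)
      + (\<integral>\<omega>. stopped_value S T \<omega> * of_bool (T \<omega> \<le> enat n) \<partial>M) = (\<integral>\<omega>. S 0 \<omega> \<partial>M)"
proof (induction n)
  note [measurable] = stopping_time_pred(3,4)[OF T]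
  case 0
  have *: "stopped_value S T \<omega> * of_bool (T \<omega> \<le> enat 0) = S 0 \<omega> * of_bool (T \<omega> \<le> enat 0)" for \<omega>
    by (cases "T \<omega>") (auto simp: stopped_value_def intro!: gr0I)
  {
    case 1
    show ?case
      unfolding * by (intro integrable_mult_of_bool integrable) measurable
  next
    case 2
    show ?case
      unfolding * using integrable
      by (subst Bochner_Integration.integral_add[symmetric])
        (auto intro!: integrable_mult_of_bool Bochner_Integration.integral_cong)
  }
next
  note [measurable] = stopping_time_pred(3,4)[OF T]
  case (Suc n)
  \<comment> \<open>The new contribution, from \<open>T \<omega> = enat (Suc n)\<close>, is written
    as a difference of two survival events, so that the martingale identity applies to the
    first.\<close>
  have *: "stopped_value S T \<omega> * of_bool (T \<omega> \<le> enat (Suc n))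
      = stopped_value S T \<omega> * of_bool (T \<omega> \<le> enat n)
        + (S (Suc n) \<omega> * of_bool (enat n < T \<omega>) - S (Suc n) \<omega> * of_bool (enat (Suc n) < T \<omega>))" for \<omega>
    by (cases "T \<omega>") (auto simp: stopped_value_def not_le le_Suc_eq)
  have int: "integrable M (\<lambda>\<omega>. S (Suc n) \<omega> * of_bool (enat i < T \<omega>))" for i
    by (intro integrable_mult_of_bool integrable) measurable
  {
    case 1
    show ?case
      unfolding * using Suc(1) int by auto
  next
    case 2
    have "(\<integral>\<omega>. S (Suc n) \<omega> * of_bool (enat n < T \<omega>) \<partial>M) = (\<integral>\<omega>. S n \<omega> * of_bool (enat n < T \<omega>) \<partial>M)"
      by (rule expectation_martingale_on[OF stopping_time_pred(2)[OF T]]) simp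
    then show ?case
      unfolding * using Suc int by simp
  }
qed

text \<open>Where \<open>T\<close> is finite, Fatou's lemma is applied to the values already stopped
  by time \<open>n\<close>; their expectations are at most \<open>E S_0\<close>, since the other
  term of the stopped process identity is nonnegative. Where \<open>T\<close> is infinite, the value
  is \<open>limit_value\<close>.\<close>

lemma integrable_stopped_value:
  assumes T: "enat_stopping_time F T"
  shows "integrable M (stopped_value S T)"
proof -
  note [measurable] = stopping_time_pred(3,4)[OF T]
  let ?X = "\<lambda>n \<omega>. stopped_value S T \<omega> * of_bool (T \<omega> \<le> enat n)"
  have fin [measurable]: "Measurable.pred M (\<lambda>\<omega>. T \<omega> = \<infinity>)"
  proof -
    have eq: "t = \<infinity> \<longleftrightarrow> (\<forall>n. enat n < t)" for t :: enat
      by (cases t) auto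
    show ?thesis
      unfolding eq by measurable
  qed
  have lim: "(\<lambda>n. ?X n \<omega>) \<longlonglongrightarrow> stopped_value S T \<omega> * of_bool (T \<omega> \<noteq> \<infinity>)" for \<omega>
  proof (cases "T \<omega>")
    case (enat N)
    then show ?thesis
      by (intro tendsto_eventually eventually_sequentiallyI[of N]) auto
  qed auto
  have "integrable M (\<lambda>\<omega>. stopped_value S T \<omega> * of_bool (T \<omega> \<noteq> \<infinity>))"
  proof (rule integral_Fatou(1))
    show "integrable M (?X n)" for n
      by (rule expectation_stopped_process(1)[OF T])
    show "AE \<omega> in M. 0 \<le> ?X n \<omega>" for n
      using nonneg_all by eventually_elim (auto simp: stopped_value_def split: enat.split)
    show "AE \<omega> in M. (\<lambda>n. ?X n \<omega>) \<longlonglongrightarrow> stopped_value S T \<omega> * of_bool (T \<omega> \<noteq> \<infinity>)"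
      using lim by simp
    show "(\<lambda>\<omega>. stopped_value S T \<omega> * of_bool (T \<omega> \<noteq> \<infinity>)) \<in> borel_measurable M"
      by (rule borel_measurable_LIMSEQ_real[OF lim
            borel_measurable_integrable[OF expectation_stopped_process(1)[OF T]]])
    have S_nonneg: "0 \<le> (\<integral>\<omega>. S n \<omega> * of_bool (enat n < T \<omega>) \<partial>M)" for n
      using nonneg[of n] by (intro integral_nonneg_AE) (auto elim!: eventually_mono)
    have "(\<integral>\<omega>. ?X n \<omega> \<partial>M) \<le> (\<integral>\<omega>. S 0 \<omega> \<partial>M)" for n
      using S_nonneg[of n] expectation_stopped_process(2)[OF T, of n] by linarith
    then show "eventually (\<lambda>n. (\<integral>\<omega>. ?X n \<omega> \<partial>M) \<le> (\<integral>\<omega>. S 0 \<omega> \<partial>M)) sequentially"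
      by simp
  qed
  moreover have "integrable M (\<lambda>\<omega>. limit_value S \<omega> * of_bool (T \<omega> = \<infinity>))"
    by (intro integrable_mult_of_bool integrable_limit_value) measurable
  ultimately have "integrable M (\<lambda>\<omega>. stopped_value S T \<omega> * of_bool (T \<omega> \<noteq> \<infinity>)
      + limit_value S \<omega> * of_bool (T \<omega> = \<infinity>))"
    by (rule Bochner_Integration.integrable_add)
  also have "(\<lambda>\<omega>. stopped_value S T \<omega> * of_bool (T \<omega> \<noteq> \<infinity>) + limit_value S \<omega> * of_bool (T \<omega> = \<infinity>))
      = stopped_value S T"
    by (auto simp: fun_eq_iff stopped_value_infinity)
  finally show ?thesis .
qed

text \<open>The stopped process identity rewrites the expectation on the left as
  \<open>E S_0\<close> minus that of \<open>?X n + ?Z n\<close>, to which dominated convergence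
  applies.\<close>

lemma stopping_defect_tendsto:
  assumes T: "enat_stopping_time F T"
  shows "(\<lambda>n. \<integral>\<omega>. (S n \<omega> - limit_value S \<omega>) * of_bool (enat n < T \<omega>) \<partial>M)
    \<longlonglongrightarrow> (\<integral>\<omega>. S 0 \<omega> \<partial>M) - (\<integral>\<omega>. stopped_value S T \<omega> \<partial>M)"
proof -
  note [measurable] = stopping_time_pred(3,4)[OF T]
  let ?X = "\<lambda>n \<omega>. stopped_value S T \<omega> * of_bool (T \<omega> \<le> enat n)"
  \<comment> \<open>Adding \<open>limit_value\<close> before stopping makes
    \<open>?X n + ?Z n\<close> converge to the stopped value on every path, including those with
    \<open>T\<close> infinite.\<close>
  let ?Z = "\<lambda>n \<omega>. limit_value S \<omega> * of_bool (enat n < T \<omega>)"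
  have X: "integrable M (?X n)" for n
    by (rule expectation_stopped_process(1)[OF T])
  have Z: "integrable M (?Z n)" for n
    by (intro integrable_mult_of_bool integrable_limit_value) measurable
  have SI: "integrable M (\<lambda>\<omega>. S n \<omega> * of_bool (enat n < T \<omega>))" for n
    by (intro integrable_mult_of_bool integrable) measurable
  have eq: "(\<integral>\<omega>. (S n \<omega> - limit_value S \<omega>) * of_bool (enat n < T \<omega>) \<partial>M)
      = (\<integral>\<omega>. S 0 \<omega> \<partial>M) - (\<integral>\<omega>. ?X n \<omega> + ?Z n \<omega> \<partial>M)" for n
    using expectation_stopped_process(2)[OF T, of n] X[of n] Z[of n] SI[of n]
    by (simp add: left_diff_distrib)
  have "(\<lambda>n. \<integral>\<omega>. ?X n \<omega> + ?Z n \<omega> \<partial>M) \<longlonglongrightarrow> (\<integral>\<omega>. stopped_value S T \<omega> \<partial>M)"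
  proof (rule integral_dominated_convergence)
    show "integrable M (\<lambda>\<omega>. \<bar>stopped_value S T \<omega>\<bar> + \<bar>limit_value S \<omega>\<bar>)"
      using integrable_stopped_value[OF T] integrable_limit_value by auto
    show "AE \<omega> in M. norm (?X n \<omega> + ?Z n \<omega>) \<le> \<bar>stopped_value S T \<omega>\<bar> + \<bar>limit_value S \<omega>\<bar>" for n
      by (auto simp: of_bool_def)
    show "AE \<omega> in M. (\<lambda>n. ?X n \<omega> + ?Z n \<omega>) \<longlonglongrightarrow> stopped_value S T \<omega>"
    proof (rule AE_I2)
      fix \<omega>
      show "(\<lambda>n. ?X n \<omega> + ?Z n \<omega>) \<longlonglongrightarrow> stopped_value S T \<omega>"
      proof (cases "T \<omega>")
        case (enat N)
        then show ?thesis
          by (intro tendsto_eventually eventually_sequentiallyI[of N]) auto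
      qed (simp add: stopped_value_infinity)
    qed
    show "stopped_value S T \<in> borel_measurable M"
      using integrable_stopped_value[OF T] by simp
    show "(\<lambda>\<omega>. ?X n \<omega> + ?Z n \<omega>) \<in> borel_measurable M" for n
      using X Z by auto
  qed
  then show ?thesis
    unfolding eq by (intro tendsto_intros)
qed

text \<open>The difference \<open>?d\<close> of the two stopping defects is the limit of the
  expectations of \<open>S n - limit_value S\<close> on \<open>?P n\<close>; Fatou's lemma shows
  that it is nonnegative.\<close>

lemma expectation_stopped_value_mono:
  assumes U: "enat_stopping_time F U" and T: "enat_stopping_time F T"
    and le: "\<And>\<omega>. U \<omega> \<le> T \<omega>"
    and conv: "AE \<omega> in M. T \<omega> = \<infinity> \<longrightarrow> (\<lambda>n. S n \<omega>) \<longlonglongrightarrow> limit_value S \<omega>"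
  shows "(\<integral>\<omega>. stopped_value S T \<omega> \<partial>M) \<le> (\<integral>\<omega>. stopped_value S U \<omega> \<partial>M)"
proof -
  note [measurable] = stopping_time_pred(3,4)[OF T] stopping_time_pred(3,4)[OF U]
  \<comment> \<open>On \<open>?P n\<close> exactly \<open>U\<close> has occurred by time
    \<open>n\<close>. Along each path this eventually agrees with \<open>?Q\<close>, where
    \<open>U\<close> is finite and \<open>T\<close> is not.\<close>
  let ?P = "\<lambda>n \<omega>. U \<omega> \<le> enat n \<and> enat n < T \<omega>"
  let ?Q = "\<lambda>\<omega>. U \<omega> \<noteq> \<infinity> \<and> T \<omega> = \<infinity>"
  let ?d = "(\<integral>\<omega>. stopped_value S U \<omega> \<partial>M) - (\<integral>\<omega>. stopped_value S T \<omega> \<partial>M)"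
  have P: "Measurable.pred M (?P n)" for n
    by measurable
  have Q_meas: "(\<lambda>\<omega>. limit_value S \<omega> * of_bool (?Q \<omega>)) \<in> borel_measurable M"
  proof -
    have eq: "t \<noteq> \<infinity> \<longleftrightarrow> (\<exists>n. t \<le> enat n)" "t = \<infinity> \<longleftrightarrow> (\<forall>n. enat n < t)" for t :: enat
      by (cases t; auto)+
    have [measurable]: "Measurable.pred M ?Q"
      unfolding eq by measurable
    show ?thesis by measurable
  qed
  have Q_tendsto: "eventually (\<lambda>n. ?P n \<omega> = ?Q \<omega>) sequentially" for \<omega>
  proof (cases "T \<omega>")
    case (enat N)
    then show ?thesis
      by (intro eventually_sequentiallyI[of N]) auto
  next
    case infinity
    then show ?thesis
      by (cases "U \<omega>") (auto intro: eventually_sequentiallyI)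
  qed
  have Z_lim: "(\<lambda>n. \<integral>\<omega>. limit_value S \<omega> * of_bool (?P n \<omega>) \<partial>M)
      \<longlonglongrightarrow> (\<integral>\<omega>. limit_value S \<omega> * of_bool (?Q \<omega>) \<partial>M)"
  proof (rule integral_dominated_convergence)
    show "integrable M (\<lambda>\<omega>. \<bar>limit_value S \<omega>\<bar>)"
      using integrable_limit_value by simp
    show "AE \<omega> in M. (\<lambda>n. limit_value S \<omega> * of_bool (?P n \<omega>)) \<longlonglongrightarrow> limit_value S \<omega> * of_bool (?Q \<omega>)"
    proof (rule AE_I2)
      fix \<omega>
      show "(\<lambda>n. limit_value S \<omega> * of_bool (?P n \<omega>)) \<longlonglongrightarrow> limit_value S \<omega> * of_bool (?Q \<omega>)"
        using Q_tendsto[of \<omega>] by (intro tendsto_eventually) (auto elim: eventually_mono)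
    qed
    show "(\<lambda>\<omega>. limit_value S \<omega> * of_bool (?P n \<omega>)) \<in> borel_measurable M" for n
      by measurable
  qed (use Q_meas in auto)
  have S_int: "integrable M (\<lambda>\<omega>. S n \<omega> * of_bool (?P n \<omega>))" for n
    by (intro integrable_mult_of_bool integrable P)
  \<comment> \<open>Fatou's lemma needs nonnegative integrands, so the \<open>limit_value\<close>
    term is added back and only \<open>S n\<close> remains on \<open>?P n\<close>.\<close>
  have "(\<integral>\<omega>. (S n \<omega> - limit_value S \<omega>) * of_bool (enat n < T \<omega>) \<partial>M)
      - (\<integral>\<omega>. (S n \<omega> - limit_value S \<omega>) * of_bool (enat n < U \<omega>) \<partial>M)
      + (\<integral>\<omega>. limit_value S \<omega> * of_bool (?P n \<omega>) \<partial>M) = (\<integral>\<omega>. S n \<omega> * of_bool (?P n \<omega>) \<partial>M)" for n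
  proof -
    have "integrable M (\<lambda>\<omega>. (S n \<omega> - limit_value S \<omega>) * of_bool (enat n < T \<omega>))"
      "integrable M (\<lambda>\<omega>. (S n \<omega> - limit_value S \<omega>) * of_bool (enat n < U \<omega>))"
      "integrable M (\<lambda>\<omega>. limit_value S \<omega> * of_bool (?P n \<omega>))"
      by (intro integrable_mult_of_bool Bochner_Integration.integrable_diff integrable
          integrable_limit_value P; measurable)+
    moreover have "S n \<omega> * of_bool (?P n \<omega>) = (S n \<omega> - limit_value S \<omega>) * of_bool (enat n < T \<omega>)
        - (S n \<omega> - limit_value S \<omega>) * of_bool (enat n < U \<omega>)
        + limit_value S \<omega> * of_bool (?P n \<omega>)" for \<omega>
      using le[of \<omega>] by (auto simp: not_le)
    ultimately show ?thesis by simp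
  qed
  moreover have "(\<lambda>n. (\<integral>\<omega>. (S n \<omega> - limit_value S \<omega>) * of_bool (enat n < T \<omega>) \<partial>M)
      - (\<integral>\<omega>. (S n \<omega> - limit_value S \<omega>) * of_bool (enat n < U \<omega>) \<partial>M)
      + (\<integral>\<omega>. limit_value S \<omega> * of_bool (?P n \<omega>) \<partial>M))
    \<longlonglongrightarrow> ?d + (\<integral>\<omega>. limit_value S \<omega> * of_bool (?Q \<omega>) \<partial>M)"
    using tendsto_add[OF tendsto_diff[OF stopping_defect_tendsto[OF T] stopping_defect_tendsto[OF U]] Z_lim]
    by simp
  ultimately have S_lim: "(\<lambda>n. \<integral>\<omega>. S n \<omega> * of_bool (?P n \<omega>) \<partial>M)
    \<longlonglongrightarrow> ?d + (\<integral>\<omega>. limit_value S \<omega> * of_bool (?Q \<omega>) \<partial>M)"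
    by simp
  \<comment> \<open>The integral over \<open>?Q\<close> stands on both sides and cancels, leaving
    \<open>0 \<le> ?d\<close>.\<close>
  have "(\<integral>\<omega>. limit_value S \<omega> * of_bool (?Q \<omega>) \<partial>M) \<le> ?d + (\<integral>\<omega>. limit_value S \<omega> * of_bool (?Q \<omega>) \<partial>M)"
  proof (rule integral_Fatou_tendsto[OF S_int _ _ Q_meas S_lim])
    show "AE \<omega> in M. 0 \<le> S n \<omega> * of_bool (?P n \<omega>)" for n
      using nonneg[of n] by eventually_elim auto
    show "AE \<omega> in M. (\<lambda>n. S n \<omega> * of_bool (?P n \<omega>)) \<longlonglongrightarrow> limit_value S \<omega> * of_bool (?Q \<omega>)"
      using conv
    proof eventually_elim
      case (elim \<omega>)
      have "(\<lambda>n. S n \<omega> * of_bool (?Q \<omega>)) \<longlonglongrightarrow> limit_value S \<omega> * of_bool (?Q \<omega>)"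
        using elim by (cases "?Q \<omega>") auto
      then show ?case
        by (rule Lim_transform_eventually) (use Q_tendsto[of \<omega>] in \<open>auto elim: eventually_mono\<close>)
    qed
  qed
  then show ?thesis by simp
qed

section \<open>Loss of mass at drawdowns\<close>

lemma AE_drawdown_after_convergent:
  "AE \<omega> in M. drawdown_after S (enat k) \<omega> = \<infinity> \<longrightarrow> (\<lambda>n. S n \<omega>) \<longlonglongrightarrow> limit_value S \<omega>"
  using AE_eventually_mono_convergent
  by eventually_elim (blast dest: drawdown_after_eq_infinityD)

lemma AE_drawdown_time_convergent:
  "AE \<omega> in M. drawdown_time S m \<omega> = \<infinity> \<longrightarrow> (\<lambda>n. S n \<omega>) \<longlonglongrightarrow> limit_value S \<omega>"
  using AE_eventually_mono_convergent
  by eventually_elim (blast dest: drawdown_time_eq_infinityD)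

text \<open>The increment \<open>Z\<close> is integrated over each event
  \<open>T \<omega> = enat j\<close> separately. There \<open>T'\<close> is the first drawdown after
  the deterministic time \<open>j\<close>, so \<open>no_loss\<close> makes each piece
  nonnegative.\<close>

lemma expectation_drawdown_time_Suc_ge:
  assumes no_loss: "\<And>k. (\<integral>\<omega>. S k \<omega> \<partial>M) \<le> (\<integral>\<omega>. stopped_value S (drawdown_after S (enat k)) \<omega> \<partial>M)"
  shows "(\<integral>\<omega>. stopped_value S (drawdown_time S m) \<omega> \<partial>M)
    \<le> (\<integral>\<omega>. stopped_value S (drawdown_time S (Suc m)) \<omega> \<partial>M)"
proof -
  define T where "T = drawdown_time S m"
  define T' where "T' = drawdown_time S (Suc m)"
  define Z where "Z \<omega> = stopped_value S T' \<omega> - stopped_value S T \<omega>" for \<omega>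
  have T: "enat_stopping_time F T" and T': "enat_stopping_time F T'"
    unfolding T_def T'_def by (rule stopping_time_drawdown_time)+
  have T'_eq: "T' \<omega> = drawdown_after S (T \<omega>) \<omega>" for \<omega>
    by (simp add: T_def T'_def)
  have int_T: "integrable M (stopped_value S T)" "integrable M (stopped_value S T')"
    using T T' by (auto intro: integrable_stopped_value)
  then have Z: "integrable M Z"
    unfolding Z_def[abs_def] by (rule Bochner_Integration.integrable_diff[rotated])
  have eqM: "Measurable.pred M (\<lambda>\<omega>. T \<omega> = enat j)" for j
    by (rule pred_F_M[OF stopping_time_eq_pred[OF T]])
  have Zj: "integrable M (\<lambda>\<omega>. Z \<omega> * of_bool (T \<omega> = enat j))" for j
    by (rule integrable_mult_of_bool[OF Z eqM])
  have Z_nonneg: "0 \<le> (\<integral>\<omega>. Z \<omega> * of_bool (T \<omega> = enat j) \<partial>M)" for j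
  proof -
    \<comment> \<open>\<open>R\<close> lies between \<open>j\<close> and the first drawdown after
      \<open>j\<close>, and its stopped value is \<open>S j\<close> plus \<open>Z\<close> restricted
      to \<open>T \<omega> = enat j\<close>.\<close>
    define R where "R \<omega> = (if T \<omega> = enat j then T' \<omega> else enat j)" for \<omega>
    have R: "enat_stopping_time F R"
      unfolding enat_stopping_time_def
    proof
      fix n
      show "Measurable.pred (F n) (\<lambda>\<omega>. R \<omega> \<le> enat n)"
      \<comment> \<open>The event \<open>T \<omega> = enat j\<close> is known from time
        \<open>j\<close> on; for \<open>n < j\<close> the event
        \<open>R \<omega> \<le> enat n\<close> is empty.\<close>
      proof (cases "j \<le> n")
        case True
        have [measurable]: "Measurable.pred (F n) (\<lambda>\<omega>. T \<omega> = enat j)"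
          by (rule pred_F_mono[OF stopping_time_eq_pred[OF T] True])
        have [measurable]: "Measurable.pred (F n) (\<lambda>\<omega>. T' \<omega> \<le> enat n)"
          by (rule stopping_time_pred(1)[OF T'])
        have "(\<lambda>\<omega>. R \<omega> \<le> enat n) = (\<lambda>\<omega>. T \<omega> = enat j \<longrightarrow> T' \<omega> \<le> enat n)"
          using True by (auto simp: R_def)
        then show ?thesis by simp
      next
        case False
        have "enat j \<le> R \<omega>" for \<omega>
          using drawdown_after_ge[of "T \<omega>" S \<omega>] by (auto simp: R_def T'_eq)
        then have "(\<lambda>\<omega>. R \<omega> \<le> enat n) = (\<lambda>\<omega>. False)"
          using False by (auto simp: fun_eq_iff) (meson enat_ord_simps(1) order_trans)
        then show ?thesis by simp
      qed
    qed
    have "(\<integral>\<omega>. S j \<omega> \<partial>M) \<le> (\<integral>\<omega>. stopped_value S (drawdown_after S (enat j)) \<omega> \<partial>M)"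
      by (rule no_loss)
    also have "\<dots> \<le> (\<integral>\<omega>. stopped_value S R \<omega> \<partial>M)"
      by (rule expectation_stopped_value_mono[OF R
            stopping_time_drawdown_after[OF stopping_time_const] _ AE_drawdown_after_convergent])
        (auto simp: R_def T'_eq drawdown_after_ge)
    also have "\<dots> = (\<integral>\<omega>. S j \<omega> + Z \<omega> * of_bool (T \<omega> = enat j) \<partial>M)"
      by (rule Bochner_Integration.integral_cong) (auto simp: R_def Z_def stopped_value_def)
    also have "\<dots> = (\<integral>\<omega>. S j \<omega> \<partial>M) + (\<integral>\<omega>. Z \<omega> * of_bool (T \<omega> = enat j) \<partial>M)"
      by (rule Bochner_Integration.integral_add[OF integrable Zj])
    finally show ?thesis by simp
  qed
  have sum_eq: "(\<Sum>j\<le>K. Z \<omega> * of_bool (T \<omega> = enat j)) = Z \<omega> * of_bool (T \<omega> \<le> enat K)" for K \<omega>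
    by (cases "T \<omega>") (auto simp: sum_distrib_left[symmetric] of_bool_def)
  have "(\<lambda>K. \<integral>\<omega>. (\<Sum>j\<le>K. Z \<omega> * of_bool (T \<omega> = enat j)) \<partial>M) \<longlonglongrightarrow> (\<integral>\<omega>. Z \<omega> \<partial>M)"
    unfolding sum_eq
  proof (rule integral_dominated_convergence)
    show "integrable M (\<lambda>\<omega>. \<bar>Z \<omega>\<bar>)" "Z \<in> borel_measurable M"
      using Z by auto
    show "(\<lambda>\<omega>. Z \<omega> * of_bool (T \<omega> \<le> enat K)) \<in> borel_measurable M" for K
      using integrable_mult_of_bool[OF Z stopping_time_pred(3)[OF T]] by auto
    show "AE \<omega> in M. (\<lambda>K. Z \<omega> * of_bool (T \<omega> \<le> enat K)) \<longlonglongrightarrow> Z \<omega>"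
    proof (rule AE_I2)
      fix \<omega>
      show "(\<lambda>K. Z \<omega> * of_bool (T \<omega> \<le> enat K)) \<longlonglongrightarrow> Z \<omega>"
      proof (cases "T \<omega>")
        case (enat N)
        then show ?thesis
          by (intro tendsto_eventually eventually_sequentiallyI[of N]) auto
      next
        \<comment> \<open>If \<open>T\<close> is infinite, so is \<open>T'\<close>, and both stopped
          values are \<open>limit_value\<close>; hence \<open>Z\<close> vanishes and the sum over
          finite \<open>j\<close> misses nothing.\<close>
        case infinity
        then show ?thesis
          by (simp add: Z_def T'_eq stopped_value_infinity)
      qed
    qed
  qed auto
  moreover have "0 \<le> (\<integral>\<omega>. (\<Sum>j\<le>K. Z \<omega> * of_bool (T \<omega> = enat j)) \<partial>M)" for K
    by (subst Bochner_Integration.integral_sum[OF Zj], rule sum_nonneg, rule Z_nonneg)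
  ultimately have "0 \<le> (\<integral>\<omega>. Z \<omega> \<partial>M)"
    by (intro LIMSEQ_le_const) auto
  then show ?thesis
    using int_T by (simp add: Z_def[abs_def] T_def T'_def del: drawdown_time.simps)
qed

text \<open>Without loss after deterministic times, the expectations along the drawdown times never
  fall below \<open>E S_0\<close>, so there is no bubble. Conversely, a loss after \<open>k\<close>
  persists until drawdown number \<open>Suc k\<close>, the witness used.\<close>

lemma bubble_iff_drawdown_after:
  "bubble M S \<longleftrightarrow>
    (\<exists>k. (\<integral>\<omega>. stopped_value S (drawdown_after S (enat k)) \<omega> \<partial>M) < (\<integral>\<omega>. S k \<omega> \<partial>M))"
proof
  assume bubble: "bubble M S"
  show "\<exists>k. (\<integral>\<omega>. stopped_value S (drawdown_after S (enat k)) \<omega> \<partial>M) < (\<integral>\<omega>. S k \<omega> \<partial>M)"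
  proof (rule ccontr)
    assume "\<not> ?thesis"
    then have no_loss:
      "\<And>k. (\<integral>\<omega>. S k \<omega> \<partial>M) \<le> (\<integral>\<omega>. stopped_value S (drawdown_after S (enat k)) \<omega> \<partial>M)"
      by (auto simp: not_less)
    have "(\<integral>\<omega>. S 0 \<omega> \<partial>M) \<le> (\<integral>\<omega>. stopped_value S (drawdown_time S m) \<omega> \<partial>M)" for m
    proof (induction m)
      case 0
      then show ?case
        by (simp add: stopped_value_def zero_enat_def)
    next
      case (Suc m)
      then show ?case
        using expectation_drawdown_time_Suc_ge[OF no_loss] by (rule order_trans)
    qed
    with bubble show False
      by (auto simp: bubble_def not_le[symmetric])
  qed
next
  assume "\<exists>k. (\<integral>\<omega>. stopped_value S (drawdown_after S (enat k)) \<omega> \<partial>M) < (\<integral>\<omega>. S k \<omega> \<partial>M)"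
  then obtain k where k:
    "(\<integral>\<omega>. stopped_value S (drawdown_after S (enat k)) \<omega> \<partial>M) < (\<integral>\<omega>. S k \<omega> \<partial>M)" ..
  have "(\<integral>\<omega>. stopped_value S (drawdown_time S (Suc k)) \<omega> \<partial>M)
      \<le> (\<integral>\<omega>. stopped_value S (drawdown_after S (enat k)) \<omega> \<partial>M)"
    by (rule expectation_stopped_value_mono[OF stopping_time_drawdown_after[OF stopping_time_const]
          stopping_time_drawdown_time _ AE_drawdown_time_convergent])
      (simp add: drawdown_after_mono drawdown_time_ge)
  also note k
  also have "(\<integral>\<omega>. S k \<omega> \<partial>M) = (\<integral>\<omega>. S 0 \<omega> \<partial>M)"
    by (rule expectation_const)
  finally show "bubble M S"
    unfolding bubble_def by (intro exI[of _ "Suc k"]) auto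
qed

text \<open>This is the stopping defect of the first drawdown after \<open>k\<close>, with
  \<open>E S_0\<close> replaced by the equal \<open>E S_k\<close>. The limit in (c) therefore always
  exists and is the loss in (b).\<close>

lemma nondecreasing_event_defect_tendsto:
  "(\<lambda>n. \<integral>\<omega>. (S n \<omega> - limit_value S \<omega>) * indicator (nondecreasing_event M S k n) \<omega> \<partial>M)
    \<longlonglongrightarrow> (\<integral>\<omega>. S k \<omega> \<partial>M) - (\<integral>\<omega>. stopped_value S (drawdown_after S (enat k)) \<omega> \<partial>M)"
proof -
  have "(\<integral>\<omega>. (S n \<omega> - limit_value S \<omega>) * indicator (nondecreasing_event M S k n) \<omega> \<partial>M)
      = (\<integral>\<omega>. (S n \<omega> - limit_value S \<omega>) * of_bool (enat n < drawdown_after S (enat k) \<omega>) \<partial>M)" for n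
    by (rule Bochner_Integration.integral_cong) (auto simp: indicator_nondecreasing_event)
  then show ?thesis
    using stopping_defect_tendsto[OF stopping_time_drawdown_after[OF stopping_time_const]]
    by (simp add: expectation_const[of k])
qed

end

theorem theorem1p4:
  fixes M :: "'a measure" and F :: "nat \<Rightarrow> 'a measure" and S :: "nat \<Rightarrow> 'a \<Rightarrow> real"
  assumes "nonneg_martingale M F S"
  shows "(bubble M S \<longleftrightarrow>
           (\<exists>k. (\<integral>\<omega>. stopped_value S (drawdown_after S (enat k)) \<omega> \<partial>M) < (\<integral>\<omega>. S k \<omega> \<partial>M)))
       \<and> (bubble M S \<longleftrightarrow>
           (\<exists>k L. (\<lambda>n. \<integral>\<omega>. (S n \<omega> - limit_value S \<omega>) * indicator (nondecreasing_event M S k n) \<omega> \<partial>M)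
                     \<longlonglongrightarrow> L \<and> L > 0))"
proof -
  interpret nonneg_martingale M F S
    by (rule assms)
  \<comment> \<open>Uniqueness of limits forces \<open>L\<close> to be the loss in (b), so its
    positivity is the strict inequality.\<close>
  have "(\<exists>L. (\<lambda>n. \<integral>\<omega>. (S n \<omega> - limit_value S \<omega>) * indicator (nondecreasing_event M S k n) \<omega> \<partial>M)
        \<longlonglongrightarrow> L \<and> L > 0)
      \<longleftrightarrow> (\<integral>\<omega>. stopped_value S (drawdown_after S (enat k)) \<omega> \<partial>M) < (\<integral>\<omega>. S k \<omega> \<partial>M)" for k
    using nondecreasing_event_defect_tendsto[of k] LIMSEQ_unique by fastforce
  then show ?thesis
    using bubble_iff_drawdown_after by simp
qed

end
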